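(* Simple $3$-$(21,7,15m)$ designs exist for every $m\in\{2,3,\ldots,102\}$.
   Context: A $t$-$(v,k,\lambda)$ design consists of a $v$-element set $P$ of points together with a collection $B$ of $k$-element subsets of $P$ (called blocks) such that every $t$-element subset of $P$ is contained in exactly $\lambda$ blocks. The design is simple if $B$ is a set, i.e. contains no repeated blocks. *)

theory Defs
  imports Main "HOL-Library.Multiset"
begin

text \<open>Blocks form a multiset, so that simplicity is a genuine condition. The conjunct
  \<open>finite P\<close> matters only for \<open>v = 0\<close>.\<close>

definition is_design :: "nat \<Rightarrow> nat \<Rightarrow> nat \<Rightarrow> nat \<Rightarrow> 'a set \<Rightarrow> 'a set multiset \<Rightarrow> bool" where
  "is_design t v k \<Lambda> P B \<longleftrightarrow>
     finite P \<and> card P = v \<and>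
     (\<forall>b \<in># B. b \<subseteq> P \<and> card b = k) \<and>
     (\<forall>T. T \<subseteq> P \<and> card T = t \<longrightarrow> size {#b \<in># B. T \<subseteq> b#} = \<Lambda>)"

definition simple_design :: "nat \<Rightarrow> nat \<Rightarrow> nat \<Rightarrow> nat \<Rightarrow> 'a set \<Rightarrow> 'a set multiset \<Rightarrow> bool" where
  "simple_design t v k \<Lambda> P B \<longleftrightarrow> is_design t v k \<Lambda> P B \<and> (\<forall>b. count B b \<le> 1)"

end

theory Submission
  imports Defs
begin

text \<open>
  Let a group \<open>G\<close> of order 120 (isomorphic to \<open>S\<^sub>5\<close>) act on the 21 points. For a union of
  \<open>G\<close>-orbits of 7-sets the number of blocks through a 3-set \<open>T\<close> depends only on the orbit of \<open>T\<close>,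
  and \<open>G\<close> has just sixteen orbits on 3-sets; so sixteen counts decide whether such a union is a
  3-design. In this way one finds pairwise disjoint \<open>G\<close>-invariant 3-(21,7,15d) designs for
  d = 2, 3, 4, 8, 16, 32, 40. Unions of some of them have index 15m, where m is the sum of the
  chosen d, and every m from 2 to 102 is such a sum.
\<close>

section \<open>A group of order 120 on 21 points\<close>

text \<open>Composition of \<open>xs\<close>, read as a function on positions, with
  \<open>p\<close>. The entry type is left open so that one operation both acts on characteristic
  vectors and multiplies permutations.\<close>

definition permute :: "nat list \<Rightarrow> 'a list \<Rightarrow> 'a list" where
  "permute p xs = map ((!) xs) p"

primrec iterates :: "nat \<Rightarrow> ('a \<Rightarrow> 'a) \<Rightarrow> 'a \<Rightarrow> 'a list" where
  "iterates 0 g x = []"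
| "iterates (Suc n) g x = x # iterates n g (g x)"

text \<open>The action of \<open>S\<^sub>5\<close> by conjugation on its twenty 3-cycles (points 0 to 19), with one more
  fixed point 20. The lists describe the permutations induced by \<open>(0 1 2 3 4)\<close>,
  \<open>x \<mapsto> 2x mod 5\<close>, \<open>(0 1 2)\<close> and \<open>(0 1)\<close>. The first two generate a group of order 20 that meets
  the \<open>S\<^sub>3\<close> generated by the other two trivially, so every group element has exactly one
  factorisation of the form enumerated by \<open>images\<close> below.\<close>

definition p5 :: "nat list" where
  "p5 = [1,2,3,4,0,6,7,8,9,5,11,12,13,14,10,16,17,18,19,15,20]"

definition p4 :: "nat list" where
  "p4 = [14,11,13,10,12,19,16,18,15,17,5,7,9,6,8,0,2,4,1,3,20]"

definition p3 :: "nat list" where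
  "p3 = [0,17,3,13,11,5,12,8,18,16,1,19,15,2,9,6,14,10,7,4,20]"

definition p2 :: "nat list" where
  "p2 = [5,12,2,13,9,0,17,7,18,4,15,14,1,3,11,10,19,6,8,16,20]"

definition gens :: "nat list list" where
  "gens = [p5, p4, p3, p2]"

definition extend :: "nat \<Rightarrow> nat list \<Rightarrow> ('a list \<Rightarrow> 'a list list) \<Rightarrow> 'a list \<Rightarrow> 'a list list" where
  "extend n p F x = concat (map F (iterates n (permute p) x))"

definition images :: "'a list \<Rightarrow> 'a list list" where
  "images = extend 2 p2 (extend 3 p3 (extend 4 p4 (extend 5 p5 (\<lambda>x. [x]))))"

definition elems :: "nat list list" where
  "elems = images [0..<21]"

lemma length_permute [simp]: "length (permute p xs) = length p"
  by (simp add: permute_def)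

lemma permute_map:
  "set p \<subseteq> {..<length xs} \<Longrightarrow> permute p (map f xs) = map f (permute p xs)"
  by (auto simp: permute_def)

lemma permute_permute:
  "set g \<subseteq> {..<length p} \<Longrightarrow> permute g (permute p xs) = permute (permute g p) xs"
  by (auto simp: permute_def)

lemma gens_check:
  "list_all (\<lambda>g. length g = 21 \<and> distinct g \<and> list_all (\<lambda>i. i < 21) g) gens"
  by code_simp

lemma gens_perm:
  assumes "g \<in> set gens"
  shows "length g = 21" "distinct g" "set g = {..<21}"
proof -
  show 1: "length g = 21" "distinct g"
    using assms gens_check by (auto simp: list_all_iff)
  have "set g \<subseteq> {..<21}"
    using assms gens_check by (auto simp: list_all_iff)
  moreover have "card (set g) = card {..<21::nat}"
    using 1 by (simp add: distinct_card)
  ultimately show "set g = {..<21}"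
    by (intro card_subset_eq) auto
qed

lemma iterates_induct:
  assumes "y \<in> set (iterates n g x)" "P x" "\<And>y. P y \<Longrightarrow> P (g y)"
  shows "P y"
  using assms(1,2) by (induction n arbitrary: x) (auto intro: assms(3))

text \<open>All of \<open>images xs\<close> is reached from \<open>xs\<close> by repeatedly applying
  generators, so facts about orbits need to be checked for the four generators only.\<close>

lemma images_induct [consumes 2, case_names base step]:
  assumes "x \<in> set (images xs)" "length xs = 21" "P xs"
    and step: "\<And>y g. g \<in> set gens \<Longrightarrow> length y = 21 \<Longrightarrow> P y \<Longrightarrow> P (permute g y)"
  shows "P x"
proof -
  let ?Q = "\<lambda>y. length y = 21 \<and> P y"
  have st: "?Q y \<Longrightarrow> ?Q (permute g y)" if "g \<in> set gens" for g y
    using that step gens_perm(1) by auto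
  obtain y2 y3 y4 where y: "y2 \<in> set (iterates 2 (permute p2) xs)"
      "y3 \<in> set (iterates 3 (permute p3) y2)" "y4 \<in> set (iterates 4 (permute p4) y3)"
      "x \<in> set (iterates 5 (permute p5) y4)"
    using assms(1) by (auto simp: images_def extend_def)
  have g: "p2 \<in> set gens" "p3 \<in> set gens" "p4 \<in> set gens" "p5 \<in> set gens"
    by (simp_all add: gens_def)
  have "?Q y2" using iterates_induct[OF y(1), of ?Q] assms(2,3) st[OF g(1)] by blast
  then have "?Q y3" using iterates_induct[OF y(2), of ?Q] st[OF g(2)] by blast
  then have "?Q y4" using iterates_induct[OF y(3), of ?Q] st[OF g(3)] by blast
  then have "?Q x" using iterates_induct[OF y(4), of ?Q] st[OF g(4)] by blast
  then show ?thesis by simp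
qed

lemma length_image:
  assumes "x \<in> set (images xs)" "length xs = 21"
  shows "length x = 21"
  using assms by (rule images_induct) (use assms(2) gens_perm in auto)

lemma self_in_extend: "n \<noteq> 0 \<Longrightarrow> x \<in> set (F x) \<Longrightarrow> x \<in> set (extend n p F x)"
  by (cases n) (simp_all add: extend_def)

lemma self_in_images: "x \<in> set (images x)"
  by (simp add: images_def self_in_extend)

section \<open>Orbit lists as images under the list of group elements\<close>

lemma iterates_map:
  assumes "g \<in> set gens" "length ys = 21"
  shows "iterates n (permute g) (map f ys) = map (map f) (iterates n (permute g) ys)"
  using assms(2)
proof (induction n arbitrary: ys)
  case (Suc n)
  then show ?case using assms(1) by (simp add: permute_map gens_perm)
qed simp

lemma length_iterates:
  assumes "g \<in> set gens" "length ys = 21" "y \<in> set (iterates n (permute g) ys)"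
  shows "length y = 21"
  using iterates_induct[OF assms(3), of "\<lambda>y. length y = 21"] assms(1,2) by (simp add: gens_perm)

lemma extend_map:
  assumes "g \<in> set gens" "length ys = 21"
    and "\<And>y. length y = 21 \<Longrightarrow> F (map f y) = map (map f) (G y)"
  shows "extend n g F (map f ys) = map (map f) (extend n g G ys)"
proof -
  have "map (F \<circ> map f) (iterates n (permute g) ys) =
      map (map (map f) \<circ> G) (iterates n (permute g) ys)"
    using assms length_iterates[OF assms(1,2)] by (intro map_cong) auto
  then show ?thesis
    unfolding extend_def iterates_map[OF assms(1,2)] map_concat map_map by (rule arg_cong)
qed

text \<open>Permuting moves positions and never inspects entries, so it commutes with renaming the
  entries.\<close>

lemma images_map: "length ys = 21 \<Longrightarrow> images (map f ys) = map (map f) (images ys)"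
  unfolding images_def by (intro extend_map) (simp_all add: gens_def)

text \<open>\<open>xs\<close> is the identity list \<open>[0..<21]\<close> renamed by
  \<open>(!) xs\<close>; hence every orbit list is determined by \<open>elems\<close>.\<close>

lemma images_eq:
  assumes "length xs = 21"
  shows "images xs = map (\<lambda>p. permute p xs) elems"
proof -
  have "images (map ((!) xs) [0..<21]) = map (map ((!) xs)) elems"
    unfolding elems_def by (rule images_map) simp
  moreover have "map ((!) xs) [0..<21] = xs"
    using assms map_nth[of xs] by simp
  ultimately show ?thesis
    by (simp add: permute_def[abs_def])
qed

section \<open>Computing the 120 group elements and their products with generators\<close>

lemma permute_eqs:
  "permute p5 [a0,a1,a2,a3,a4,a5,a6,a7,a8,a9,a10,a11,a12,a13,a14,a15,a16,a17,a18,a19,a20] =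
    [a1,a2,a3,a4,a0,a6,a7,a8,a9,a5,a11,a12,a13,a14,a10,a16,a17,a18,a19,a15,a20]"
  "permute p4 [a0,a1,a2,a3,a4,a5,a6,a7,a8,a9,a10,a11,a12,a13,a14,a15,a16,a17,a18,a19,a20] =
    [a14,a11,a13,a10,a12,a19,a16,a18,a15,a17,a5,a7,a9,a6,a8,a0,a2,a4,a1,a3,a20]"
  "permute p3 [a0,a1,a2,a3,a4,a5,a6,a7,a8,a9,a10,a11,a12,a13,a14,a15,a16,a17,a18,a19,a20] =
    [a0,a17,a3,a13,a11,a5,a12,a8,a18,a16,a1,a19,a15,a2,a9,a6,a14,a10,a7,a4,a20]"
  "permute p2 [a0,a1,a2,a3,a4,a5,a6,a7,a8,a9,a10,a11,a12,a13,a14,a15,a16,a17,a18,a19,a20] =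
    [a5,a12,a2,a13,a9,a0,a17,a7,a18,a4,a15,a14,a1,a3,a11,a10,a19,a6,a8,a16,a20]"
  by (simp_all add: permute_def p5_def p4_def p3_def p2_def)

lemma upt_21: "[0..<21] = [0,1,2,3,4,5,6,7,8,9,10,11,12,13,14,15,16,17,18,19,20]"
  by (simp add: upt_rec)

lemma extend_Suc: "extend (Suc n) p F x = F x @ extend n p F (permute p x)"
  by (simp add: extend_def)

lemma extend_numeral:
  "extend 5 p F x = F x @ extend 4 p F (permute p x)"
  "extend 4 p F x = F x @ extend 3 p F (permute p x)"
  "extend 3 p F x = F x @ extend 2 p F (permute p x)"
  "extend 2 p F x = F x @ F (permute p x)"
  subgoal using extend_Suc[of 4 p F x] by simp
  subgoal using extend_Suc[of 3 p F x] by simp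
  subgoal using extend_Suc[of 2 p F x] by simp
  subgoal by (simp add: extend_def numeral_2_eq_2)
  done

definition and_then :: "bool \<Rightarrow> ('a \<Rightarrow> bool) \<Rightarrow> 'a \<Rightarrow> bool" where
  "and_then b f x \<longleftrightarrow> b \<and> f x"

definition or_else :: "bool \<Rightarrow> ('a \<Rightarrow> bool) \<Rightarrow> 'a \<Rightarrow> bool" where
  "or_else b f x \<longleftrightarrow> b \<or> f x"

definition covers :: "'a list \<Rightarrow> 'a list \<Rightarrow> bool" where
  "covers ys xs \<longleftrightarrow> set xs \<subseteq> set ys"

text \<open>Passing the function and its argument separately keeps the simplifier from evaluating the
  second condition before the first one is decided.\<close>
lemma lazy_list_simps:
  "(x # xs = y # ys) = and_then (x = y) ((=) xs) ys"
  "(x \<in> set (y # ys)) = or_else (x = y) ((\<in>) x) (set ys)"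
  "distinct (x # xs) = and_then (x \<notin> set xs) distinct xs"
  "covers ys (x # xs) = and_then (x \<in> set ys) (covers ys) xs"
  "and_then True f z = f z" "and_then False f z = False"
  "or_else True f z = True" "or_else False f z = f z"
  "(x \<in> set []) = False" "distinct [] = True" "covers ys [] = True" "([] = []) = True"
  "((0::nat) = 0) = True" "((1::nat) = 1) = True"
  by (auto simp: and_then_def or_else_def covers_def)

lemmas elems_eval = elems_def upt_21 images_def extend_numeral permute_eqs append_Cons append_Nil
  lazy_list_simps not_True_eq_False not_False_eq_True rel_simps

lemma length_elems_eq: "length elems = 120"
  by (simp add: elems_def images_def extend_numeral)

lemma distinct_elems: "distinct elems"
  by (simp only: elems_eval)

lemma covers_map_permute_elems:
  "covers elems (map (permute p5) elems)" "covers elems (map (permute p4) elems)"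
  "covers elems (map (permute p3) elems)" "covers elems (map (permute p2) elems)"
  by (simp_all only: elems_eval list.map)

lemma covers_images_gens:
  "covers elems (images p5)" "covers elems (images p4)"
  "covers elems (images p3)" "covers elems (images p2)"
  \<comment> \<open>Only the argument of \<open>images\<close> is unfolded: the terms
    \<open>permute p5\<close> etc. arising from \<open>images_def\<close> must stay folded to match
    \<open>permute_eqs\<close>.\<close>
  by (simp_all only: arg_cong[where f = images, OF p5_def] arg_cong[where f = images, OF p4_def]
      arg_cong[where f = images, OF p3_def] arg_cong[where f = images, OF p2_def])
    (simp_all only: elems_eval)

text \<open>\<open>permute g p\<close> is \<open>p\<close> after \<open>g\<close>, so the two
  inclusions are closure under multiplication by a generator on the right and, via
  \<open>images_eq\<close>, on the left.\<close>

lemma elems_closed: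
  assumes "g \<in> set gens"
  shows "set (map (permute g) elems) \<subseteq> set elems" "set (images g) \<subseteq> set elems"
  using assms covers_map_permute_elems covers_images_gens unfolding covers_def gens_def by auto

lemma length_images: "length xs = 21 \<Longrightarrow> length (images xs) = 120"
  by (simp add: images_eq length_elems_eq)

lemma length_elems: "p \<in> set elems \<Longrightarrow> length p = 21"
  unfolding elems_def by (erule length_image) simp

lemma set_elems:
  assumes "p \<in> set elems"
  shows "set p \<subseteq> {..<21}"
proof -
  have "p \<in> set (images [0..<21])" "length [0..<21] = 21"
    using assms by (simp_all add: elems_def)
  then show ?thesis
  proof (induction rule: images_induct)
    case (step y g)
    then have "set (permute g y) \<subseteq> set y"
      by (auto simp: permute_def gens_perm)
    with step show ?case by blast
  qed auto
qed

section \<open>Invariance and multiplicities of orbit lists\<close>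

lemma inj_permute:
  assumes "g \<in> set gens" "length x = 21" "length y = 21" "permute g x = permute g y"
  shows "x = y"
proof (rule nth_equalityI)
  fix i assume "i < length x"
  then have "i \<in> set g" using assms gens_perm(3) by simp
  then show "x ! i = y ! i" using assms(4) by (simp add: permute_def)
qed (use assms in simp)

lemma mset_map_bij:
  assumes "distinct L" "inj_on f (set L)" "f ` set L \<subseteq> set L"
  shows "mset (map f L) = mset L"
proof -
  have "f ` set L = set L"
    using assms by (intro endo_inj_surj) auto
  then have "set (map f L) = set L" by simp
  then show ?thesis
    using assms by (subst set_eq_iff_mset_eq_distinct[symmetric]) (auto simp: distinct_map)
qed

text \<open>Right multiplication by \<open>g\<close> permutes \<open>elems\<close>. Multisets retain
  the repetitions caused by nontrivial stabilisers.\<close>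

lemma mset_permute_images:
  assumes "g \<in> set gens" "length xs = 21"
  shows "mset (map (permute g) (images xs)) = mset (images xs)"
proof -
  have "mset (map (permute g) elems) = mset elems"
  proof (rule mset_map_bij)
    show "inj_on (permute g) (set elems)"
      by (rule inj_onI, rule inj_permute[OF assms(1)]) (simp_all add: length_elems)
    show "permute g ` set elems \<subseteq> set elems"
      using elems_closed(1)[OF assms(1)] by simp
  qed (rule distinct_elems)
  then have "image_mset (\<lambda>p. permute p xs) (mset (map (permute g) elems)) =
      image_mset (\<lambda>p. permute p xs) (mset elems)"
    by (rule arg_cong)
  moreover have "map (permute g) (images xs) = map (\<lambda>p. permute p xs) (map (permute g) elems)"
    using assms by (auto simp: images_eq permute_permute gens_perm length_elems)
  ultimately show ?thesis
    using assms by (metis images_eq mset_map)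
qed

text \<open>Left multiplication by \<open>g\<close> permutes \<open>elems\<close>, so starting from
  another orbit element only reorders the list.\<close>

lemma mset_images_permute:
  assumes "g \<in> set gens" "length xs = 21"
  shows "mset (images (permute g xs)) = mset (images xs)"
proof -
  have sub: "set p \<subseteq> {..<21}" if "p \<in> set elems" for p
    using that by (rule set_elems)
  have "mset (map (\<lambda>p. permute p g) elems) = mset elems"
  proof (rule mset_map_bij)
    show "inj_on (\<lambda>p. permute p g) (set elems)"
    proof (rule inj_onI)
      fix p q assume pq: "p \<in> set elems" "q \<in> set elems" "permute p g = permute q g"
      have "inj_on ((!) g) (set p \<union> set q)"
        using gens_perm(1,2)[OF assms(1)] sub[OF pq(1)] sub[OF pq(2)]
        by (intro inj_on_nth) auto
      then show "p = q"
        using pq(3) by (simp add: permute_def inj_on_map_eq_map)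
    qed
    show "(\<lambda>p. permute p g) ` set elems \<subseteq> set elems"
      using elems_closed(2)[OF assms(1)] images_eq[OF gens_perm(1)[OF assms(1)]] by simp
  qed (rule distinct_elems)
  then have "image_mset (\<lambda>p. permute p xs) (mset (map (\<lambda>p. permute p g) elems)) =
      image_mset (\<lambda>p. permute p xs) (mset elems)"
    by (rule arg_cong)
  moreover have "images (permute g xs) = map (\<lambda>p. permute p xs) (map (\<lambda>p. permute p g) elems)"
    using assms sub by (auto simp: images_eq permute_permute gens_perm)
  ultimately show ?thesis
    using assms by (metis images_eq mset_map)
qed

lemma mset_images_image:
  "x \<in> set (images xs) \<Longrightarrow> length xs = 21 \<Longrightarrow> mset (images x) = mset (images xs)"
  by (induction rule: images_induct) (auto simp: mset_images_permute)

lemma count_image_mset_inj_on: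
  assumes "inj_on f A" "set_mset M \<subseteq> A" "y \<in> A"
  shows "count (image_mset f M) (f y) = count M y"
proof -
  have "f -` {f y} \<inter> set_mset M = (if y \<in># M then {y} else {})"
    using assms by (auto simp: inj_on_def)
  then show ?thesis
    by (auto simp: count_image_mset not_in_iff)
qed

text \<open>Orbit-stabiliser in list form: \<open>permute g\<close> is injective and preserves the
  multiset, so the multiplicity is constant along the orbit.\<close>

lemma count_images:
  assumes "x \<in> set (images K)" "length K = 21"
  shows "count (mset (images K)) x = count (mset (images K)) K"
  using assms
proof (induction rule: images_induct)
  case (step y g)
  have "inj_on (permute g) {x. length x = 21}"
    using inj_permute step(1) by (auto simp: inj_on_def)
  then have "count (image_mset (permute g) (mset (images K))) (permute g y) = count (mset (images K)) y"
    using assms(2) step(2) length_image by (intro count_image_mset_inj_on) auto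
  then show ?case
    using step mset_permute_images[OF step(1) assms(2)] by simp
qed simp

section \<open>Orbits of blocks\<close>

definition supp :: "bool list \<Rightarrow> nat set" where
  "supp x = {i. i < 21 \<and> x ! i}"

text \<open>Entry \<open>i\<close> of \<open>permute g x\<close> is entry \<open>g ! i\<close> of
  \<open>x\<close>: supports are pulled back along \<open>g\<close>, and \<open>g\<close> carries
  them forward again.\<close>

lemma supp_permute:
  assumes "g \<in> set gens"
  shows "(!) g ` supp (permute g x) = supp x"
proof -
  have "set g = (!) g ` {..<21}"
    using gens_perm(1)[OF assms] by (metis list.set_map map_nth set_upt atLeast_upt)
  then have *: "(!) g ` {..<21} = {..<21}" using gens_perm(3)[OF assms] by simp
  have "(!) g ` supp (permute g x) = (!) g ` {..<21} \<inter> {i. x ! i}"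
    using gens_perm(1)[OF assms] by (auto simp: supp_def permute_def)
  then show ?thesis unfolding * by (auto simp: supp_def)
qed

lemma inj_on_gens: "g \<in> set gens \<Longrightarrow> inj_on ((!) g) {..<21}"
  using gens_perm by (intro inj_on_nth) auto

lemma supp_subset: "supp x \<subseteq> {..<21}"
  by (auto simp: supp_def)

lemma supp_permute_subset_iff:
  assumes "g \<in> set gens"
  shows "supp (permute g t) \<subseteq> supp (permute g x) \<longleftrightarrow> supp t \<subseteq> supp x"
proof
  assume "supp (permute g t) \<subseteq> supp (permute g x)"
  then have "(!) g ` supp (permute g t) \<subseteq> (!) g ` supp (permute g x)" by (rule image_mono)
  then show "supp t \<subseteq> supp x" by (simp only: supp_permute[OF assms])
next
  assume sub: "supp t \<subseteq> supp x"
  show "supp (permute g t) \<subseteq> supp (permute g x)"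
  proof
    fix i assume i: "i \<in> supp (permute g t)"
    have g: "length g = 21" by (rule gens_perm(1)[OF assms])
    have "g ! i \<in> supp t"
      using i supp_permute[OF assms, of t] by (metis imageI)
    then have "g ! i \<in> supp x" using sub by blast
    then show "i \<in> supp (permute g x)"
      using i g by (simp add: supp_def permute_def)
  qed
qed

lemma card_supp_image:
  "x \<in> set (images K) \<Longrightarrow> length K = 21 \<Longrightarrow> card (supp x) = card (supp K)"
proof (induction rule: images_induct)
  case (step y g)
  have "card ((!) g ` supp (permute g y)) = card (supp (permute g y))"
    using inj_on_gens[OF step(1)] supp_subset by (intro card_image) (rule inj_on_subset)
  then show ?case using step by (simp add: supp_permute)
qed simp

lemma inj_supp: "inj_on supp {x. length x = 21}"
proof (rule inj_onI)
  fix x y :: "bool list" assume xy: "x \<in> {x. length x = 21}" "y \<in> {x. length x = 21}" "supp x = supp y"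
  show "x = y"
  proof (rule nth_equalityI)
    fix i assume "i < length x"
    then show "x ! i = y ! i" using xy by (auto simp: supp_def set_eq_iff)
  qed (use xy in simp)
qed

definition hits :: "bool list \<Rightarrow> bool list \<Rightarrow> nat" where
  "hits K t = length (filter (\<lambda>x. supp t \<subseteq> supp x) (images K))"

text \<open>Moving \<open>t\<close> by \<open>g\<close> is compensated by moving all images of
  \<open>K\<close> by \<open>g\<close>, which only reorders them. Hence one count per orbit of
  triples suffices.\<close>

lemma hits_image:
  assumes "t' \<in> set (images t)" "length t = 21" "length K = 21"
  shows "hits K t' = hits K t"
  using assms(1,2)
proof (induction rule: images_induct)
  case (step t g)
  have hits_mset: "hits K t = size (filter_mset (\<lambda>x. supp t \<subseteq> supp x) (mset (images K)))" for t
    by (simp add: hits_def flip: mset_filter)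
  have "hits K (permute g t) =
      size (filter_mset (\<lambda>x. supp (permute g t) \<subseteq> supp x) (image_mset (permute g) (mset (images K))))"
    using mset_permute_images[OF step(1) assms(3)] by (simp add: hits_mset)
  also have "\<dots> = hits K t"
    by (simp add: hits_mset filter_mset_image_mset supp_permute_subset_iff[OF step(1)])
  finally show ?case using step by simp
qed simp

text \<open>A block stands for its orbit if it is the lexicographically greatest element. Summing \<open>tie K\<close>
  over the 120 images of \<open>K\<close> gives the order of the stabiliser plus 1000 for every image that
  beats \<open>K\<close>, so divisibility of 120 by \<open>stab K\<close> certifies maximality as well.\<close>

fun tie :: "bool list \<Rightarrow> bool list \<Rightarrow> nat \<Rightarrow> nat" where
  "tie (a # xs) (b # ys) s = (if a = b then tie xs ys s else if a then s else s + 1000)"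
| "tie _ _ s = s + 1"

definition stab :: "bool list \<Rightarrow> nat" where
  "stab K = fold (tie K) (images K) 0"

lemma tie_add: "tie x y s = s + tie x y 0"
  by (induction x y s rule: tie.induct) auto

lemma tie_refl: "tie x x 0 = 1"
  by (induction x) auto

lemma tie_neq:
  "length x = length y \<Longrightarrow> x \<noteq> y \<Longrightarrow>
    tie x y 0 = 0 \<and> tie y x 0 = 1000 \<or> tie x y 0 = 1000 \<and> tie y x 0 = 0"
  by (induction x y rule: list_induct2) auto

lemma fold_tie: "fold (tie K) L s = s + (\<Sum>x\<leftarrow>L. tie K x 0)"
proof (induction L arbitrary: s)
  case (Cons x L)
  then show ?case using tie_add[of K x s] by simp
qed simp

text \<open>A single penalty of 1000 would push the total beyond 120, the largest divisor of
  120.\<close>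

lemma stab_canonical:
  assumes "stab K dvd 120" "x \<in> set (images K)"
  shows "tie K x 0 < 1000"
proof -
  have "tie K x 0 \<le> stab K"
    using assms(2) by (simp add: stab_def fold_tie member_le_sum_list)
  also have "\<dots> \<le> 120" using assms(1) by (rule dvd_imp_le) simp
  finally show ?thesis by simp
qed

lemma sum_list_indicator: "(\<Sum>x\<leftarrow>L. if x = y then 1 else 0) = count (mset L) y"
  by (induction L) auto

text \<open>Without penalties, exactly the images equal to \<open>K\<close> contribute, one
  each.\<close>

lemma stab_eq_count:
  assumes "stab K dvd 120" "length K = 21"
  shows "stab K = count (mset (images K)) K"
proof -
  have "tie K x 0 = (if x = K then 1 else 0)" if "x \<in> set (images K)" for x
    using stab_canonical[OF assms(1) that] tie_neq[of K x] tie_refl length_image[OF that assms(2)] assms(2)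
    by auto
  then have "stab K = (\<Sum>x\<leftarrow>images K. if x = K then 1 else 0)"
    by (simp add: stab_def fold_tie cong: map_cong)
  also have "\<dots> = count (mset (images K)) K"
    by (rule sum_list_indicator)
  finally show ?thesis .
qed

section \<open>Disjoint orbits and counting in their unions\<close>

text \<open>A common element makes the orbits equal, so each representative is an image of the
  other; of two distinct vectors one beats the other, contradicting maximality.\<close>

lemma images_disjoint:
  assumes "length K = 21" "length K' = 21" "stab K dvd 120" "stab K' dvd 120"
    "x \<in> set (images K)" "x \<in> set (images K')"
  shows "K = K'"
proof (rule ccontr)
  assume "K \<noteq> K'"
  have "set (images K) = set (images K')"
    using mset_images_image[of x K] mset_images_image[of x K'] assms by (metis set_mset_mset)
  then have "tie K K' 0 < 1000" "tie K' K 0 < 1000"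
    using stab_canonical assms(3,4) self_in_images by blast+
  then show False using tie_neq[of K K'] \<open>K \<noteq> K'\<close> assms(1,2) by auto
qed

lemma stab_mult_card:
  assumes "stab K dvd 120" "length K = 21"
  shows "stab K * card {x \<in> set (images K). Q x} = length (filter Q (images K))"
proof -
  have "length (filter Q (images K)) = size (filter_mset Q (mset (images K)))"
    by (simp flip: mset_filter)
  also have "\<dots> = (\<Sum>x\<in>{x \<in> set (images K). Q x}. stab K)"
    unfolding size_multiset_overloaded_eq
    using assms by (intro sum.cong) (auto simp: count_images simp flip: stab_eq_count[OF assms])
  finally show ?thesis by simp
qed

definition orbit_union :: "bool list set \<Rightarrow> bool list set" where
  "orbit_union R = (\<Union>K\<in>R. set (images K))"

text \<open>The factor 120 clears denominators: orbit elements occur \<open>stab K\<close> times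
  among the images, and \<open>120 div stab K\<close> times \<open>stab K\<close> is 120.\<close>

lemma card_orbit_union:
  assumes "finite R" "\<And>K. K \<in> R \<Longrightarrow> length K = 21 \<and> stab K dvd 120"
  shows "120 * card {x \<in> orbit_union R. Q x} =
    (\<Sum>K\<in>R. 120 div stab K * length (filter Q (images K)))"
proof -
  have "{x \<in> orbit_union R. Q x} = (\<Union>K\<in>R. {x \<in> set (images K). Q x})"
    by (auto simp: orbit_union_def)
  also have "card \<dots> = (\<Sum>K\<in>R. card {x \<in> set (images K). Q x})"
    using assms images_disjoint by (intro card_UN_disjoint) auto
  finally have "120 * card {x \<in> orbit_union R. Q x} =
      (\<Sum>K\<in>R. 120 * card {x \<in> set (images K). Q x})"
    by (simp add: sum_distrib_left)
  also have "\<dots> = (\<Sum>K\<in>R. 120 div stab K * length (filter Q (images K)))"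
  proof (rule sum.cong)
    fix K assume "K \<in> R"
    then have K: "length K = 21" "stab K dvd 120" using assms(2) by auto
    then have "120 = 120 div stab K * stab K" by simp
    then have "120 * card {x \<in> set (images K). Q x} =
        120 div stab K * (stab K * card {x \<in> set (images K). Q x})"
      by (metis mult.assoc)
    then show "120 * card {x \<in> set (images K). Q x} =
        120 div stab K * length (filter Q (images K))"
      by (simp only: stab_mult_card[OF K(2,1)])
  qed simp
  finally show ?thesis .
qed

primrec bits :: "nat \<Rightarrow> nat \<Rightarrow> bool list" where
  "bits 0 n = []"
| "bits (Suc k) n = odd n # bits k (n div 2)"

text \<open>Blocks are numbered by their characteristic vectors, with point 0 as the least significant
  bit.\<close>

abbreviation block :: "nat \<Rightarrow> bool list" where
  "block \<equiv> bits 21"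

lemma length_bits [simp]: "length (bits k n) = k"
  by (induction k arbitrary: n) auto

lemma bits_inj:
  "bits k m = bits k n \<Longrightarrow> m < 2 ^ k \<Longrightarrow> n < 2 ^ k \<Longrightarrow> m = n"
proof (induction k arbitrary: m n)
  case (Suc k)
  then have "m div 2 = n div 2" "even m = even n" by auto
  then show ?case by (metis dvd_mult_div_cancel odd_two_times_div_two_succ)
qed simp

text \<open>Representatives of the sixteen orbits on 3-sets.\<close>

definition triples :: "nat list" where
  "triples = [7, 11, 35, 37, 69, 131, 261, 515, 1027, 2051, 4161, 65539,
    1048579, 1048581, 1048609, 1048641]"

text \<open>\<open>tally\<close> computes, for each of the sixteen triples, 120 times the number of blocks containing
  it: a block orbit of length \<open>120 div s\<close> is counted over all 120 images, hence \<open>s\<close> times.\<close>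

definition add_hits :: "nat \<Rightarrow> bool list \<Rightarrow> nat list \<Rightarrow> nat list" where
  "add_hits w x ns = map2 (\<lambda>t n. if supp (block t) \<subseteq> supp x then n + w else n) triples ns"

definition tally_block :: "bool list \<Rightarrow> nat \<Rightarrow> nat list \<Rightarrow> nat list" where
  "tally_block K s ns = fold (add_hits (120 div s)) (images K) ns"

definition tally :: "nat list \<Rightarrow> nat list \<Rightarrow> nat list" where
  "tally L ns = fold (\<lambda>n. tally_block (block n) (stab (block n))) L ns"

text \<open>The certificate of a representative: \<open>2097152\<close> is \<open>2 ^ 21\<close>, so
  the block determines \<open>n\<close>, and the divisibility certifies maximality in the
  orbit.\<close>

definition valid :: "nat \<Rightarrow> nat \<Rightarrow> bool" where
  "valid k n \<longleftrightarrow> n < 2097152 \<and> length (filter (\<lambda>b. b) (block n)) = k \<and> stab (block n) dvd 120"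

lemma length_add_hits: "length ns = 16 \<Longrightarrow> length (add_hits w x ns) = 16"
  by (simp add: add_hits_def triples_def)

lemma fold_add_hits:
  assumes "length ns = 16" "i < 16"
  shows "length (fold (add_hits w) xs ns) = 16 \<and> fold (add_hits w) xs ns ! i =
    ns ! i + w * length (filter (\<lambda>x. supp (block (triples ! i)) \<subseteq> supp x) xs)"
  using assms
proof (induction xs arbitrary: ns)
  case (Cons x xs)
  have "add_hits w x ns ! i =
      (if supp (block (triples ! i)) \<subseteq> supp x then ns ! i + w else ns ! i)"
    using Cons.prems by (simp add: add_hits_def triples_def)
  then show ?case
    using Cons.IH[OF length_add_hits[OF Cons.prems(1)] Cons.prems(2)] by simp
qed simp

lemma tally_nth:
  assumes "length ns = 16" "i < 16"
  shows "length (tally L ns) = 16 \<and> tally L ns ! i =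
    ns ! i + (\<Sum>n\<leftarrow>L. 120 div stab (block n) * hits (block n) (block (triples ! i)))"
  using assms(1)
proof (induction L arbitrary: ns)
  case (Cons n L)
  have *: "tally (n # L) ns = tally L (tally_block (block n) (stab (block n)) ns)"
    by (simp add: tally_def)
  show ?case
    unfolding * tally_block_def
    using Cons.IH[OF conjunct1[OF fold_add_hits[OF Cons.prems assms(2)]]]
      fold_add_hits[OF Cons.prems assms(2)]
    by (simp add: hits_def)
qed (simp add: tally_def)

section \<open>Evaluation by rewriting\<close>

text \<open>Consumes the iterates as they are produced, so that rewriting never builds the list of
  120 images.\<close>

definition fold_iter :: "nat \<Rightarrow> ('a \<Rightarrow> 'a) \<Rightarrow> ('a \<Rightarrow> 'b \<Rightarrow> 'b) \<Rightarrow> 'a \<Rightarrow> 'b \<Rightarrow> 'b" where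
  "fold_iter n g f x = fold f (iterates n g x)"

lemma fold_iter_Suc: "fold_iter (Suc n) g f x a = fold_iter n g f (g x) (f x a)"
  by (simp add: fold_iter_def)

lemma fold_iter_numeral:
  "fold_iter 5 g f x a = fold_iter 4 g f (g x) (f x a)"
  "fold_iter 4 g f x a = fold_iter 3 g f (g x) (f x a)"
  "fold_iter 3 g f x a = fold_iter 2 g f (g x) (f x a)"
  "fold_iter 2 g f x a = f (g x) (f x a)"
  subgoal using fold_iter_Suc[of 4 g f x a] by simp
  subgoal using fold_iter_Suc[of 3 g f x a] by simp
  subgoal using fold_iter_Suc[of 2 g f x a] by simp
  subgoal by (simp add: fold_iter_def numeral_2_eq_2)
  done

lemma fold_extend: "fold f (extend n p F x) = fold_iter n (permute p) (\<lambda>y. fold f (F y)) x"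
proof -
  have "fold f (concat (map F ys)) = fold (\<lambda>y. fold f (F y)) ys" for ys
    by (induction ys) auto
  then show ?thesis by (simp add: extend_def fold_iter_def)
qed

lemma fold_images:
  "fold f (images x) a = fold_iter 2 (permute p2) (fold_iter 3 (permute p3)
    (fold_iter 4 (permute p4) (fold_iter 5 (permute p5) f))) x a"
  by (simp add: images_def fold_extend)

text \<open>The three membership tests are separate arguments so that \<open>bump_simps\<close> can
  stop at the first absent point.\<close>

definition bump :: "nat \<Rightarrow> bool \<Rightarrow> bool \<Rightarrow> bool \<Rightarrow> nat \<Rightarrow> nat" where
  "bump w a b c n = (if a \<and> b \<and> c then n + w else n)"

lemma bump_simps:
  "bump w False b c n = n" "bump w True False c n = n"
  "bump w True True False n = n" "bump w True True True n = n + w"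
  by (simp_all add: bump_def)

text \<open>With the length in unary, \<open>bits_simps\<close> peels off one \<open>Suc\<close> per
  binary digit of the numeral.\<close>

lemma block_unary: "block n = bits (Suc (Suc (Suc (Suc (Suc (Suc (Suc (Suc (Suc (Suc (Suc (Suc (Suc (Suc
    (Suc (Suc (Suc (Suc (Suc (Suc (Suc 0))))))))))))))))))))) n"
  by (rule arg_cong[where f = "\<lambda>k. bits k n"]) simp

lemma bits_simps:
  "bits 0 n = []"
  "bits (Suc k) 0 = False # bits k 0"
  "bits (Suc k) 1 = True # bits k 0"
  "bits (Suc k) (numeral (Num.Bit0 q)) = False # bits k (numeral q)"
  "bits (Suc k) (numeral (Num.Bit1 q)) = True # bits k (numeral q)"
  "bits (Suc k) (numeral Num.One) = True # bits k 0"
  by simp_all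

lemma supp_subset_iff_list_all2:
  assumes "length t = 21" "length x = 21"
  shows "supp t \<subseteq> supp x \<longleftrightarrow> list_all2 (\<longrightarrow>) t x"
  using assms by (auto simp: supp_def list_all2_conv_all_nth)

lemma supp_block_bump:
  assumes "list_all2 (\<longrightarrow>) (block t) x \<longleftrightarrow> a \<and> b \<and> c" "length x = 21"
  shows "(if supp (block t) \<subseteq> supp x then n + w else n) = bump w a b c n"
  using assms by (simp add: bump_def supp_subset_iff_list_all2)

text \<open>The indices are the points of the triples; for instance \<open>35 = 1 + 2 + 32\<close>
  encodes the points 0, 1 and 5.\<close>

lemma add_hits_eq:
  "add_hits w [a0,a1,a2,a3,a4,a5,a6,a7,a8,a9,a10,a11,a12,a13,a14,a15,a16,a17,a18,a19,a20]
     [n0,n1,n2,n3,n4,n5,n6,n7,n8,n9,n10,n11,n12,n13,n14,n15] =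
   [bump w a0 a1 a2 n0, bump w a0 a1 a3 n1, bump w a0 a1 a5 n2, bump w a0 a2 a5 n3,
    bump w a0 a2 a6 n4, bump w a0 a1 a7 n5, bump w a0 a2 a8 n6, bump w a0 a1 a9 n7,
    bump w a0 a1 a10 n8, bump w a0 a1 a11 n9, bump w a0 a6 a12 n10, bump w a0 a1 a16 n11,
    bump w a0 a1 a20 n12, bump w a0 a2 a20 n13, bump w a0 a5 a20 n14, bump w a0 a6 a20 n15]"
  unfolding add_hits_def triples_def list.map zip_Cons_Cons zip_Nil prod.case list.inject
  by (intro conjI supp_block_bump refl) (simp_all add: block_unary)

lemma tie_simps:
  "tie (True # xs) (True # ys) s = tie xs ys s"
  "tie (True # xs) (False # ys) s = s"
  "tie (False # xs) (False # ys) s = tie xs ys s"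
  "tie (False # xs) (True # ys) s = s + 1000"
  "tie [] [] s = s + 1"
  by simp_all

lemma stab_divs:
  "(120::nat) div 1 = 120" "(120::nat) div 2 = 60" "(120::nat) div 3 = 40"
  "(120::nat) div 4 = 30" "(120::nat) div 6 = 20" "(120::nat) div 12 = 10"
  by simp_all

lemma stab_dvds:
  "(1::nat) dvd 120" "(2::nat) dvd 120" "(3::nat) dvd 120"
  "(4::nat) dvd 120" "(6::nat) dvd 120" "(12::nat) dvd 120"
  by simp_all

lemma fold_simps: "fold f [] a = a" "fold f (x # xs) a = fold f xs (f x a)"
  by simp_all

lemmas stab_eval = stab_def fold_images fold_iter_numeral permute_eqs tie_simps block_unary bits_simps
  add_0 one_add_one numeral_plus_one numeral_plus_numeral add_num_simps

lemma length_filter_eval: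
  "length (filter (\<lambda>b. b) []) = 0"
  "length (filter (\<lambda>b. b) (False # bs)) = length (filter (\<lambda>b. b) bs)"
  "length (filter (\<lambda>b. b) (True # bs)) = length (filter (\<lambda>b. b) bs) + 1"
  by simp_all

lemmas valid_eval = valid_def list.pred_inject stab_eval stab_dvds length_filter_eval
  less_num_simps le_num_simps numeral_less_iff simp_thms

lemmas tally_eval = tally_def tally_block_def stab_eval fold_simps stab_divs add_hits_eq bump_simps

section \<open>Seven disjoint designs\<close>

text \<open>Orbit representatives of pairwise disjoint 3-(21,7,15d) designs, found by a computer search
  for 0-1 solutions of the Kramer-Mesner system.\<close>

definition reps2 :: "nat list" where
  "reps2 = [
    17063, 18479, 33823, 110723, 147783, 294991, 335887, 1050919, 1057095, 1082467, 1220615]"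

definition reps3 :: "nat list" where
  "reps3 = [
    1615, 24967, 33935, 73807, 86279, 132239, 266343, 526383, 526607, 528463, 1048939, 1050375,
    1083431, 1089607, 1116423, 1122443]"

definition reps4 :: "nat list" where
  "reps4 = [
    1199, 10535, 19495, 25103, 41231, 43079, 67727, 149519, 149767, 164135, 196903, 264335,
    295015, 557135, 1049359, 1050183, 1052815, 1187879, 1198087, 1245199, 1245223]"

definition reps8 :: "nat list" where
  "reps8 = [
    1831, 8495, 9263, 28935, 33103, 37135, 37987, 65743, 65959, 68111, 78087, 81967, 82247,
    131431, 132175, 133671, 135311, 135695, 164111, 172071, 197383, 266319, 395303, 526479,
    593935, 786575, 1052875, 1053063, 1053711, 1057067, 1057295, 1058831, 1066055, 1098053,
    1115175, 1131019, 1179943, 1180199, 1181767, 1572911, 1573007]"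

definition reps16 :: "nat list" where
  "reps16 = [
    1707, 1807, 2159, 2255, 4303, 5167, 5263, 5287, 8399, 8527, 8751, 12367, 16495, 17167, 17995,
    26663, 34959, 37159, 41103, 66607, 66703, 67143, 67691, 67783, 68623, 73899, 74255, 82983,
    86031, 90127, 131135, 131407, 131855, 131911, 132367, 133447, 139343, 151567, 163919, 197671,
    198151, 262351, 263215, 327759, 328327, 328839, 393767, 395335, 426023, 524943, 561167,
    589967, 593959, 688143, 1049383, 1049703, 1050951, 1052843, 1058855, 1058887, 1060935,
    1065287, 1065547, 1066503, 1069127, 1069575, 1081639, 1082383, 1083655, 1114279, 1116259,
    1118247, 1122343, 1181735, 1245703, 1311247, 1314951, 1327119, 1442311, 1572943, 1605647,
    1640455]"

definition reps32 :: "nat list" where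
  "reps32 = [
    1383, 2111, 2383, 2407, 2663, 3151, 3623, 4207, 4271, 5227, 5291, 6191, 6223, 8255, 8551,
    8647, 10823, 16615, 16807, 16943, 17455, 18983, 20623, 20751, 20775, 21127, 21575, 22663,
    25351, 26887, 28743, 33191, 33327, 34895, 34919, 36911, 37903, 41007, 41255, 41287, 43271,
    45319, 49199, 49447, 66191, 66639, 66731, 67879, 67911, 69679, 70159, 74055, 74503, 77895,
    82191, 82311, 82503, 90755, 131375, 131631, 131663, 132263, 132623, 133167, 135751, 139407,
    139791, 147535, 147751, 147983, 148039, 149543, 163983, 164879, 180263, 196655, 196711,
    200719, 262255, 262799, 263199, 263311, 263719, 263751, 264239, 264775, 267279, 270479,
    278631, 295439, 295975, 296975, 301063, 327823, 394311, 409639, 524351, 525071, 526415,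
    532527, 532559, 540751, 591887, 606223, 720935, 1048751, 1049167, 1049191, 1049259, 1049647,
    1049679, 1050151, 1050767, 1051663, 1052839, 1053255, 1053319, 1053739, 1056815, 1058951,
    1061127, 1065351, 1065607, 1066119, 1067271, 1069071, 1073191, 1073795, 1081391, 1081615,
    1085703, 1114283, 1114667, 1114759, 1114763, 1115207, 1115271, 1118279, 1130511, 1131527,
    1138695, 1179727, 1179919, 1180175, 1180743, 1180771, 1180935, 1181219, 1183759, 1187911,
    1196295, 1212455, 1310823, 1311271, 1313287, 1376295, 1376775, 1572967, 1573135, 1574927,
    1589263, 1589287]"

definition reps40 :: "nat list" where
  "reps40 = [
    1327, 2447, 2639, 2703, 2727, 3119, 4455, 4495, 4519, 5199, 5647, 7207, 7239, 8303, 8847,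
    8975, 9031, 9359, 10343, 10407, 10439, 10567, 12431, 12459, 16743, 16783, 17679, 17703, 17959,
    18059, 18535, 18703, 18727, 20559, 20871, 21007, 21063, 24847, 32975, 33167, 34063, 35111,
    35143, 36943, 37007, 41039, 41063, 43047, 49295, 53263, 53511, 65935, 66095, 66127, 66375,
    66663, 66831, 67087, 67207, 67663, 69711, 69903, 70671, 73775, 73871, 73999, 74023, 77839,
    82023, 82063, 82215, 82471, 83079, 86535, 90183, 98631, 106759, 131471, 131727, 132127,
    132143, 133199, 133287, 133703, 134183, 135215, 135439, 140303, 147599, 180487, 196751,
    196879, 204839, 205063, 262207, 262735, 262823, 262855, 263695, 264271, 264743, 266287,
    266383, 266439, 270415, 270863, 278575, 278671, 280615, 328231, 328263, 328743, 393319,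
    394255, 394279, 524399, 524495, 524879, 525583, 525839, 526439, 527375, 528431, 529423,
    530447, 544783, 590095, 655407, 655439, 655503, 671783, 1049415, 1049743, 1049871, 1050187,
    1050671, 1050703, 1050731, 1050923, 1051175, 1051207, 1051687, 1052775, 1052943, 1053199,
    1053735, 1054791, 1056847, 1056871, 1057063, 1060907, 1065007, 1065039, 1065611, 1066023,
    1066059, 1066123, 1066247, 1067023, 1067047, 1069191, 1069319, 1073415, 1081375, 1114255,
    1114407, 1114411, 1114439, 1114503, 1114663, 1115179, 1115683, 1116199, 1118347, 1122347,
    1122375, 1122467, 1130535, 1130759, 1134599, 1147143, 1179695, 1179975, 1180423, 1180711,
    1197063, 1245255, 1310767, 1310799, 1311815, 1311879, 1312263, 1312807, 1312839, 1314831,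
    1318927, 1376391, 1573391, 1576975, 1703951]"

definition reps :: "nat \<Rightarrow> nat list" where
  "reps d = (if d = 2 then reps2 else if d = 3 then reps3 else if d = 4 then reps4
    else if d = 8 then reps8 else if d = 16 then reps16 else if d = 32 then reps32 else reps40)"

lemma replicate_16: "replicate 16 a = [a,a,a,a,a,a,a,a,a,a,a,a,a,a,a,a]"
  by (simp add: eval_nat_numeral)

text \<open>The target is \<open>120 * 15 * d\<close> with \<open>d = 2\<close>; the later lists
  have the target \<open>1800 * d\<close> in the same way.\<close>

lemma tally_reps2: "tally reps2 (replicate 16 0) = replicate 16 3600"
  by (simp only: reps2_def replicate_16 tally_eval)

lemma valid_reps2: "list_all (valid 7) reps2"
  by (simp only: reps2_def valid_eval)

lemma tally_reps3: "tally reps3 (replicate 16 0) = replicate 16 5400"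
  by (simp only: reps3_def replicate_16 tally_eval)

lemma valid_reps3: "list_all (valid 7) reps3"
  by (simp only: reps3_def valid_eval)

lemma tally_reps4: "tally reps4 (replicate 16 0) = replicate 16 7200"
  by (simp only: reps4_def replicate_16 tally_eval)

lemma valid_reps4: "list_all (valid 7) reps4"
  by (simp only: reps4_def valid_eval)

lemma tally_reps8: "tally reps8 (replicate 16 0) = replicate 16 14400"
  by (simp only: reps8_def replicate_16 tally_eval)

lemma valid_reps8: "list_all (valid 7) reps8"
  by (simp only: reps8_def valid_eval)

lemma tally_reps16: "tally reps16 (replicate 16 0) = replicate 16 28800"
  by (simp only: reps16_def replicate_16 tally_eval)

lemma valid_reps16: "list_all (valid 7) reps16"
  by (simp only: reps16_def valid_eval)

lemma tally_reps32: "tally reps32 (replicate 16 0) = replicate 16 57600"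
  by (simp only: reps32_def replicate_16 tally_eval)

lemma valid_reps32: "list_all (valid 7) reps32"
  by (simp only: reps32_def valid_eval)

lemma tally_reps40: "tally reps40 (replicate 16 0) = replicate 16 72000"
  by (simp only: reps40_def replicate_16 tally_eval)

lemma valid_reps40: "list_all (valid 7) reps40"
  by (simp only: reps40_def valid_eval)

text \<open>Distinctness across all seven lists makes the designs pairwise disjoint, since distinct
  maximal representatives have disjoint orbits.\<close>

lemma distinct_reps: "distinct (reps2 @ reps3 @ reps4 @ reps8 @ reps16 @ reps32 @ reps40)"
  by (simp only: reps2_def reps3_def reps4_def reps8_def reps16_def reps32_def reps40_def
      append_Cons append_Nil lazy_list_simps not_False_eq_True rel_simps)

lemma valid_triples: "list_all (valid 3) triples"
  by (simp only: triples_def valid_eval)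

lemma orbit_sizes_triples: "map (\<lambda>n. 120 div stab (block n)) triples =
    [120, 120, 120, 60, 120, 120, 120, 120, 120, 20, 40, 60, 60, 60, 10, 60]"
  by (simp only: triples_def list.map stab_eval stab_divs)

section \<open>Assembling the designs\<close>

lemma valid_block:
  assumes "valid k n"
  shows "n < 2 ^ 21" "card (supp (block n)) = k" "stab (block n) dvd 120"
  using assms length_filter_conv_card[of "\<lambda>b. b" "block n"] by (auto simp: valid_def supp_def)

lemma inj_block: "(\<And>n. n \<in> A \<Longrightarrow> \<exists>k. valid k n) \<Longrightarrow> inj_on block A"
  using bits_inj valid_block(1) by (metis inj_onI)

text \<open>The sixteen orbits are disjoint and their lengths add up to 1330, the number of
  3-subsets of 21 points, so no triple is missed.\<close>

lemma triple_in_orbit: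
  assumes "length t = 21" "card (supp t) = 3"
  obtains i where "i < 16" "t \<in> set (images (block (triples ! i)))"
proof -
  let ?R = "block ` set triples"
  have v: "valid 3 n" if "n \<in> set triples" for n
    using valid_triples that by (auto simp: list_all_iff)
  have inj: "inj_on block (set triples)"
    using v by (intro inj_block) blast
  have "distinct triples" by (simp add: triples_def)
  have R: "length K = 21 \<and> stab K dvd 120" if "K \<in> ?R" for K
    using that valid_block(3)[OF v] by auto
  have "120 * card (orbit_union ?R) = (\<Sum>K\<in>?R. 120 div stab K * 120)"
    using card_orbit_union[OF _ R, where Q = "\<lambda>_. True"] by (simp add: length_images R)
  also have "\<dots> = (\<Sum>n\<leftarrow>triples. 120 div stab (block n)) * 120"
    using \<open>distinct triples\<close>
    by (simp add: sum.reindex[OF inj] sum_list_distinct_conv_sum_set flip: sum_distrib_right)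
  also have "\<dots> = 1330 * 120"
    by (simp add: orbit_sizes_triples)
  finally have card_orb: "card (orbit_union ?R) = 1330" by simp
  let ?T = "{x :: bool list. length x = 21 \<and> card (supp x) = 3}"
  have sub: "orbit_union ?R \<subseteq> ?T"
  proof
    fix x assume "x \<in> orbit_union ?R"
    then obtain n where n: "n \<in> set triples" "x \<in> set (images (block n))"
      by (auto simp: orbit_union_def)
    then show "x \<in> ?T"
      using length_image[OF n(2)] card_supp_image[OF n(2)] valid_block(2)[OF v[OF n(1)]] by simp
  qed
  have inj_T: "inj_on supp ?T"
    using inj_supp by (rule inj_on_subset) auto
  have supp_T: "supp ` ?T \<subseteq> {A. A \<subseteq> {..<21} \<and> card A = 3}"
    using supp_subset by auto
  have fin: "finite {A. A \<subseteq> {..<21::nat} \<and> card A = 3}"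
    by (rule finite_subset[of _ "Pow {..<21}"]) auto
  have "card ?T \<le> card {A. A \<subseteq> {..<21::nat} \<and> card A = 3}"
    using inj_T supp_T fin by (rule card_inj_on_le)
  also have "card {A. A \<subseteq> {..<21::nat} \<and> card A = 3} = 1330"
    \<comment> \<open>The instance is \<open>21 * (20 choose 2) = (21 choose 3) * 3\<close>.\<close>
    using Suc_times_binomial_eq[of 20 2] by (simp add: n_subsets choose_two)
  finally have "orbit_union ?R = ?T"
    using card_orb sub finite_imageD[OF finite_subset[OF supp_T fin] inj_T] by (intro card_seteq) auto
  then have "t \<in> orbit_union ?R" using assms by simp
  then obtain n where "n \<in> set triples" "t \<in> set (images (block n))"
    by (auto simp: orbit_union_def)
  moreover have "length triples = 16" by (simp add: triples_def)
  ultimately show thesis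
    using that by (metis in_set_conv_nth)
qed

lemma reps_eqs:
  "reps 2 = reps2" "reps 3 = reps3" "reps 4 = reps4" "reps 8 = reps8"
  "reps 16 = reps16" "reps 32 = reps32" "reps 40 = reps40"
  by (simp_all add: reps_def)

lemma tally_reps:
  assumes "d \<in> {2,3,4,8,16,32,40}"
  shows "tally (reps d) (replicate 16 0) = replicate 16 (1800 * d)"
  using assms
  by (elim insertE emptyE) (simp_all only: reps_eqs tally_reps2 tally_reps3 tally_reps4 tally_reps8
      tally_reps16 tally_reps32 tally_reps40 numeral_times_numeral mult_num_simps add_num_simps)

lemma valid_reps:
  assumes "d \<in> {2,3,4,8,16,32,40}" "n \<in> set (reps d)"
  shows "valid 7 n"
proof -
  have "list_all (valid 7) (reps d)"
    using assms(1)
    by (elim insertE emptyE) (simp_all only: reps_eqs valid_reps2 valid_reps3 valid_reps4 valid_reps8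
        valid_reps16 valid_reps32 valid_reps40)
  then show ?thesis using assms(2) by (simp add: list_all_iff)
qed

lemma distinct_concat_mapD:
  "distinct (concat (map f ds)) \<Longrightarrow> d \<in> set ds \<Longrightarrow> distinct (f d)"
  by (induction ds) auto

lemma disjoint_concat_mapD:
  "distinct (concat (map f ds)) \<Longrightarrow> d \<in> set ds \<Longrightarrow> e \<in> set ds \<Longrightarrow> d \<noteq> e \<Longrightarrow>
    set (f d) \<inter> set (f e) = {}"
  by (induction ds) auto

lemma reps_distinct_disjoint:
  assumes "d \<in> {2,3,4,8,16,32,40}" "e \<in> {2,3,4,8,16,32,40}"
  shows "distinct (reps d)" "d \<noteq> e \<Longrightarrow> set (reps d) \<inter> set (reps e) = {}"
proof -
  have "concat (map reps [2,3,4,8,16,32,40]) =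
      reps2 @ reps3 @ reps4 @ reps8 @ reps16 @ reps32 @ reps40"
    by (simp add: reps_eqs)
  then have "distinct (concat (map reps [2,3,4,8,16,32,40]))"
    by (simp only: distinct_reps)
  from distinct_concat_mapD[OF this, of d] disjoint_concat_mapD[OF this, of d e] assms
  show "distinct (reps d)" "d \<noteq> e \<Longrightarrow> set (reps d) \<inter> set (reps e) = {}"
    by simp_all
qed

text \<open>The Kramer-Mesner condition: each of the sixteen triples receives the same count, scaled
  by 120.\<close>

lemma sum_hits_reps:
  assumes "d \<in> {2,3,4,8,16,32,40}" "i < 16"
  shows "(\<Sum>n\<in>set (reps d). 120 div stab (block n) * hits (block n) (block (triples ! i))) = 1800 * d"
proof -
  have "(\<Sum>n\<leftarrow>reps d. 120 div stab (block n) * hits (block n) (block (triples ! i))) =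
      tally (reps d) (replicate 16 0) ! i"
    using tally_nth[of "replicate 16 0" i "reps d"] assms(2) by simp
  also have "\<dots> = 1800 * d"
    unfolding tally_reps[OF assms(1)] using assms(2) by (rule nth_replicate)
  finally show ?thesis
    by (simp only: sum_list_distinct_conv_sum_set[OF reps_distinct_disjoint(1)[OF assms(1,1)]])
qed

section \<open>Subset sums of the seven indices\<close>

primrec sums :: "nat list \<Rightarrow> nat list" where
  "sums [] = [0]"
| "sums (x # xs) = map ((+) x) (sums xs) @ sums xs"

text \<open>Distinctness ensures that adding the head to a sum corresponds to inserting a new
  element into the subset.\<close>

lemma sums_subset:
  assumes "m \<in> set (sums xs)" "distinct xs"
  shows "\<exists>S \<subseteq> set xs. \<Sum>S = m"
  using assms
proof (induction xs arbitrary: m)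
  case (Cons x xs)
  consider "m \<in> set (sums xs)" | k where "k \<in> set (sums xs)" "m = x + k"
    using Cons.prems(1) by auto
  then show ?case
  proof cases
    case 1
    then show ?thesis using Cons.IH[of m] Cons.prems(2) by auto
  next
    case 2
    then obtain S where S: "S \<subseteq> set xs" "\<Sum>S = k"
      using Cons.IH[of k] Cons.prems(2) by auto
    then have "finite S" "x \<notin> S"
      using Cons.prems(2) finite_subset by auto
    then have "\<Sum>(insert x S) = m" using S(2) 2(2) by simp
    then show ?thesis using S(1) by (intro exI[of _ "insert x S"]) auto
  qed
qed simp

lemma subset_sums:
  fixes m :: nat
  assumes "m \<in> {2..102}"
  obtains S where "S \<subseteq> {2,3,4,8,16,32,40}" "\<Sum>S = m"
proof -
  \<comment> \<open>All 128 subset sums are computed, and each target from 2 to 102 is found among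
    them.\<close>
  have "covers (sums [2,3,4,8,16,32,40]) [2..<103]"
    by (simp only: sums.simps list.map append_Cons append_Nil add_0_right numeral_plus_numeral
        add_num_simps upt_rec_numeral Suc_numeral if_True if_False lazy_list_simps rel_simps
        cong: if_weak_cong)
  then have "m \<in> set (sums [2,3,4,8,16,32,40])"
    using assms by (auto simp only: covers_def set_upt atLeastAtMost_iff atLeastLessThan_iff subset_iff)
  then show thesis
    using sums_subset[of m "[2,3,4,8,16,32,40]"] that by auto
qed

theorem theorem5:
  fixes m :: nat
  assumes "m \<in> {2..102}"
  shows "\<exists>(P :: nat set) B. simple_design 3 21 7 (15 * m) P B"
proof -
  obtain S where S: "S \<subseteq> {2,3,4,8,16,32,40}" "\<Sum>S = m"
    using assms by (rule subset_sums)
  have "finite S" using S(1) by (rule finite_subset) simp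
  \<comment> \<open>\<open>N\<close> collects the orbit representatives of the chosen designs;
    \<open>X\<close> consists of the characteristic vectors of all blocks.\<close>
  define N where "N = (\<Union>d\<in>S. set (reps d))"
  define X where "X = orbit_union (block ` N)"
  have "finite N" using \<open>finite S\<close> by (simp add: N_def)
  have v: "valid 7 n" if n: "n \<in> N" for n
  proof -
    obtain d where d: "d \<in> S" "n \<in> set (reps d)"
      using n by (auto simp only: N_def)
    show ?thesis
      by (rule valid_reps[OF subsetD[OF S(1) d(1)] d(2)])
  qed
  have inj: "inj_on block N"
    using v by (intro inj_block) blast
  have X: "length x = 21 \<and> card (supp x) = 7" if x: "x \<in> X" for x
  proof -
    obtain n where n: "n \<in> N" "x \<in> set (images (block n))"
      using x by (auto simp: X_def orbit_union_def)
    then show ?thesis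
      using length_image[OF n(2)] card_supp_image[OF n(2)] valid_block(2)[OF v[OF n(1)]] by simp
  qed
  have "finite X" using \<open>finite N\<close> by (simp add: X_def orbit_union_def)
  have count: "card {x \<in> X. T \<subseteq> supp x} = 15 * m" if T: "T \<subseteq> {..<21}" "card T = 3" for T
  proof -
    define t where "t = map (\<lambda>i. i \<in> T) [0..<21]"
    have t: "length t = 21" "supp t = T"
      using T(1) by (auto simp: t_def supp_def)
    obtain i where i: "i < 16" "t \<in> set (images (block (triples ! i)))"
      using triple_in_orbit[of t] t T(2) by auto
    have "120 * card {x \<in> X. supp t \<subseteq> supp x} =
        (\<Sum>K\<in>block ` N. 120 div stab K * hits K t)"
      unfolding X_def hits_def using \<open>finite N\<close> valid_block(3)[OF v]
      by (intro card_orbit_union) auto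
    \<comment> \<open>Both \<open>hits\<close> and the orbit are shared by \<open>t\<close> and its
      representative triple, which brings in the computed tallies.\<close>
    also have "\<dots> = (\<Sum>n\<in>N. 120 div stab (block n) * hits (block n) (block (triples ! i)))"
      using hits_image[OF i(2)] by (simp add: sum.reindex[OF inj])
    also have "\<dots> = (\<Sum>d\<in>S. \<Sum>n\<in>set (reps d).
        120 div stab (block n) * hits (block n) (block (triples ! i)))"
      unfolding N_def
    proof (rule sum.UNION_disjoint)
      show "\<forall>d\<in>S. \<forall>e\<in>S. d \<noteq> e \<longrightarrow> set (reps d) \<inter> set (reps e) = {}"
        by (intro ballI impI reps_distinct_disjoint(2) subsetD[OF S(1)])
    qed (simp_all add: \<open>finite S\<close>)
    also have "\<dots> = (\<Sum>d\<in>S. 1800 * d)"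
      by (intro sum.cong refl sum_hits_reps subsetD[OF S(1)] i(1))
    also have "\<dots> = 1800 * m"
      using S(2) by (simp flip: sum_distrib_left)
    finally show ?thesis using t by simp
  qed
  \<comment> \<open>A multiset built from a set has multiplicities at most one, which gives
    simplicity; injectivity of \<open>supp\<close> transfers the counts from vectors to
    blocks.\<close>
  define B where "B = mset_set (supp ` X)"
  have inj_X: "inj_on supp X"
    using inj_supp by (rule inj_on_subset) (use X in auto)
  have "size {#b \<in># B. T \<subseteq> b#} = 15 * m" if T: "T \<subseteq> {..<21} \<and> card T = 3" for T
  proof -
    have "size {#b \<in># B. T \<subseteq> b#} = card {b \<in> supp ` X. T \<subseteq> b}"
      using \<open>finite X\<close> by (simp add: B_def)
    also have "{b \<in> supp ` X. T \<subseteq> b} = supp ` {x \<in> X. T \<subseteq> supp x}" by auto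
    also have "card \<dots> = card {x \<in> X. T \<subseteq> supp x}"
      using inj_X by (intro card_image) (auto intro: inj_on_subset)
    also have "\<dots> = 15 * m" using T count by simp
    finally show ?thesis .
  qed
  moreover have "\<forall>b\<in>#B. b \<subseteq> {..<21} \<and> card b = 7"
    using \<open>finite X\<close> X supp_subset by (auto simp: B_def)
  moreover have "\<forall>b. count B b \<le> 1"
    by (simp add: B_def count_mset_set')
  ultimately have "simple_design 3 21 7 (15 * m) {..<21} B"
    by (simp add: simple_design_def is_design_def)
  then show ?thesis by blast
qed

end
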